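(* Let $n\ge 2$, let $\mathbf a_1,\dots,\mathbf a_n\in\mathbb R^n$ be non-zero-variance vectors with standardized vectors $\mathbf a_1',\dots,\mathbf a_n'$, and let $\mathbf A=[\mathbf a_1',\mathbf a_2',\dots,\mathbf a_n']$ be the $n\times n$ matrix with columns $\mathbf a_i'$. Then $$\omega_{\mathbf a_1\mathbf a_2\cdots\mathbf a_n}^2=(\det\mathbf A)^2 .$$
   Context: For $\mathbf a=(a_1,\dots,a_n)^T\in\mathbb R^n$ let $\mu_{\mathbf a}=\frac1n\sum_{i=1}^n a_i$ and let $\mathbf 1$ be the all-ones vector; $\mathbf a$ is a non-zero-variance vector if $\mathbf a-\mu_{\mathbf a}\mathbf 1\neq 0$. In that case its standardized vector is $\mathbf a'=\frac{\mathbf a-\mu_{\mathbf a}\mathbf 1}{\|\mathbf a-\mu_{\mathbf a}\mathbf 1\|}$ (Euclidean norm). For non-zero-variance vectors $\mathbf a_1,\dots,\mathbf a_m\in\mathbb R^n$ ($2\le m\le n$) with standardized vectors $\mathbf a_i'=(a'_{i1},\dots,a'_{in})^T$, and for $1\le j_1<\cdots<j_m\le n$, let $[\mathbf a'(m)\,|\,j_1,\dots,j_m]$ be the $m\times m$ matrix with $(i,k)$ entry $a'_{i j_k}$. The unsigned incorrelation coefficient $\omega_{\mathbf a_1\cdots\mathbf a_m}\ge0$ is defined by $$\omega_{\mathbf a_1\cdots\mathbf a_m}^2=\sum_{1\le j_1<\cdots<j_m\le n}\bigl(\det[\mathbf a'(m)\,|\,j_1,\dots,j_m]\bigr)^2 .$$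 *)

theory Defs
  imports "Jordan_Normal_Form.Determinant" "HOL-Analysis.L2_Norm"
begin

definition vec_mean :: "real vec \<Rightarrow> real" where
  "vec_mean a = (\<Sum>i<dim_vec a. a $ i) / real (dim_vec a)"

definition all_ones_vec :: "nat \<Rightarrow> real vec" where
  "all_ones_vec n = vec n (\<lambda>_. 1)"

definition centered :: "real vec \<Rightarrow> real vec" where
  "centered a = a - vec_mean a \<cdot>\<^sub>v all_ones_vec (dim_vec a)"

definition nonzero_variance :: "real vec \<Rightarrow> bool" where
  "nonzero_variance a \<longleftrightarrow> centered a \<noteq> 0\<^sub>v (dim_vec a)"

definition euclid_norm :: "real vec \<Rightarrow> real" where
  "euclid_norm v = L2_set (\<lambda>i. v $ i) {..<dim_vec v}"

definition standardized :: "real vec \<Rightarrow> real vec" where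
  "standardized a = (1 / euclid_norm (centered a)) \<cdot>\<^sub>v centered a"

(* The vectors are the rows: entry (i, k) is coordinate js ! k of the i-th standardized vector. *)
definition selected_matrix :: "real vec list \<Rightarrow> nat list \<Rightarrow> real mat" where
  "selected_matrix as js =
     mat (length as) (length js) (\<lambda>(i, k). standardized (as ! i) $ (js ! k))"

(* The m-tuples j_1 < ... < j_m of coordinate indices; indices run over 0, ..., n - 1. *)
definition increasing_tuples :: "nat \<Rightarrow> nat \<Rightarrow> nat list set" where
  "increasing_tuples n m = {js. length js = m \<and> sorted_wrt (<) js \<and> set js \<subseteq> {..<n}}"

(* The number m of vectors is length as; the vectors are meant to lie in carrier_vec n.
   The sum of squares determines the square of the coefficient, and sqrt picks its
   nonnegative root. *)
definition incorrelation :: "nat \<Rightarrow> real vec list \<Rightarrow> real" where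
  "incorrelation n as =
     sqrt (\<Sum>js\<in>increasing_tuples n (length as). (det (selected_matrix as js))\<^sup>2)"

end

theory Submission
  imports Defs
begin

text \<open>With as many vectors as coordinates there is only one increasing choice of indices, so
  the sum collapses to one squared determinant. Its matrix is the transpose of A, and transposition
  preserves determinants.\<close>

lemma increasing_tuples_full: "increasing_tuples n n = {[0..<n]}"
proof -
  have "js = [0..<n]" if "length js = n" "sorted_wrt (<) js" "set js \<subseteq> {..<n}" for js
  proof -
    have "distinct js" and "sorted js"
      using that(2) by (simp_all add: strict_sorted_iff)
    \<comment> \<open>Counting: n distinct indices below n exhaust \<open>{..<n}\<close>, and a
      sorted distinct list is determined by its set.\<close>
    have "card (set js) = n"
      using \<open>distinct js\<close> that(1) by (simp add: distinct_card)
    then have "set js = {..<n}"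
      using that(3) by (intro card_subset_eq) simp_all
    then show ?thesis
      using \<open>distinct js\<close> \<open>sorted js\<close>
      by (intro sorted_distinct_set_unique) (auto simp: atLeast0LessThan)
  qed
  then show ?thesis
    by (auto simp: increasing_tuples_def)
qed

text \<open>The transpose arises because \<open>selected_matrix\<close> stores the vectors as rows,
  \<open>mat_of_cols\<close> as columns.\<close>

lemma selected_matrix_full:
  "selected_matrix as [0..<n] = (mat_of_cols n (map standardized as))\<^sup>T"
  by (rule eq_matI) (auto simp: selected_matrix_def mat_of_cols_index)

theorem corollary3:
  fixes n :: nat and as :: "real vec list"
  assumes "n \<ge> 2"
    and "length as = n"
    and "set as \<subseteq> carrier_vec n"
    and "\<forall>a\<in>set as. nonzero_variance a"
  shows "(incorrelation n as)\<^sup>2 = (det (mat_of_cols n (map standardized as)))\<^sup>2"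
proof -
  \<comment> \<open>\<open>det_transpose\<close> needs a square matrix; \<open>length as = n\<close>
    provides this.\<close>
  have "mat_of_cols n (map standardized as) \<in> carrier_mat n n"
    using assms(2) mat_of_cols_carrier(1)[of n "map standardized as"] by simp
  then show ?thesis
    using assms(2)
    by (simp add: incorrelation_def increasing_tuples_full selected_matrix_full det_transpose)
qed

end
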